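(* Let $g:\Omega\to\mathbb{R}$ be a bounded real (measurable) function, let $\phi_0,\phi_1,\ldots,\phi_n$ be orthonormal functions in $\mathcal{L}_w^2(\Omega)$, and let $\boldsymbol{M}_n[g]$ be the $(n+1)\times(n+1)$ matrix with elements $[\boldsymbol{M}_n[g]]_{i,j}=\langle \phi_i, g\,\phi_j\rangle$, $i,j=0,1,\ldots,n$. Then all eigenvalues of $\boldsymbol{M}_n[g]$ lie in the closed interval $[\inf g,\sup g]$, where $\inf g=\inf_{\boldsymbol{x}\in\Omega}g(\boldsymbol{x})$ and $\sup g=\sup_{\boldsymbol{x}\in\Omega}g(\boldsymbol{x})$.
   Context: $\Omega\subset\mathbb{R}^d$, and $w:\Omega\to[0,\infty)$ is a weight function normalized so that $\int_\Omega w(\boldsymbol{x})\,d\boldsymbol{x}=1$. $\mathcal{L}_w^2(\Omega)$ is the Hilbert space of (complex-valued) functions, square integrable with respect to $w(\boldsymbol{x})\,d\boldsymbol{x}$ and identified when equal almost everywhere with respect to this measure, with inner product $\langle\phi,\psi\rangle=\int_\Omega\overline{\phi(\boldsymbol{x})}\,\psi(\boldsymbol{x})\,w(\boldsymbol{x})\,d\boldsymbol{x}$. Matrix indices start at $0$. The matrix $\boldsymbol{M}_n[g]$ is Hermitian for real $g$. *)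

theory Defs
  imports
    "HOL-Analysis.Analysis"
    "Jordan_Normal_Form.Char_Poly"
begin

(* The weight is only constrained on \<Omega>; its values outside are irrelevant. *)
definition normalized_weight :: "(real ^ 'd) set \<Rightarrow> (real ^ 'd \<Rightarrow> real) \<Rightarrow> bool" where
  "normalized_weight \<Omega> w \<longleftrightarrow>
     (\<forall>x\<in>\<Omega>. 0 \<le> w x) \<and>
     integrable (lebesgue_on \<Omega>) w \<and>
     (LINT x|lebesgue_on \<Omega>. w x) = 1"

(* Elements of the Hilbert space are represented by square-integrable functions. The inner
   product below depends only on their classes modulo w(x)dx-almost-everywhere equality
   (see wL2_inner_cong), so it is the one of the quotient space. *)
definition wL2 :: "(real ^ 'd) set \<Rightarrow> (real ^ 'd \<Rightarrow> real) \<Rightarrow> (real ^ 'd \<Rightarrow> complex) set" where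
  "wL2 \<Omega> w = {\<phi>. \<phi> \<in> borel_measurable (lebesgue_on \<Omega>) \<and>
                  integrable (lebesgue_on \<Omega>) (\<lambda>x. (cmod (\<phi> x))\<^sup>2 * w x)}"

definition wL2_inner ::
  "(real ^ 'd) set \<Rightarrow> (real ^ 'd \<Rightarrow> real) \<Rightarrow> (real ^ 'd \<Rightarrow> complex) \<Rightarrow> (real ^ 'd \<Rightarrow> complex) \<Rightarrow> complex"
  where
  "wL2_inner \<Omega> w \<phi> \<psi> = (LINT x|lebesgue_on \<Omega>. cnj (\<phi> x) * \<psi> x * complex_of_real (w x))"

definition wL2_orthonormal ::
  "(real ^ 'd) set \<Rightarrow> (real ^ 'd \<Rightarrow> real) \<Rightarrow> nat \<Rightarrow> (nat \<Rightarrow> real ^ 'd \<Rightarrow> complex) \<Rightarrow> bool" where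
  "wL2_orthonormal \<Omega> w n \<phi> \<longleftrightarrow>
     (\<forall>i\<le>n. \<phi> i \<in> wL2 \<Omega> w) \<and>
     (\<forall>i\<le>n. \<forall>j\<le>n. wL2_inner \<Omega> w (\<phi> i) (\<phi> j) = (if i = j then 1 else 0))"

definition multiplication_matrix ::
  "(real ^ 'd) set \<Rightarrow> (real ^ 'd \<Rightarrow> real) \<Rightarrow> (nat \<Rightarrow> real ^ 'd \<Rightarrow> complex) \<Rightarrow> nat \<Rightarrow>
   (real ^ 'd \<Rightarrow> real) \<Rightarrow> complex Matrix.mat" where
  "multiplication_matrix \<Omega> w \<phi> n g =
     Matrix.mat (n + 1) (n + 1)
       (\<lambda>(i, j). wL2_inner \<Omega> w (\<phi> i) (\<lambda>x. complex_of_real (g x) * \<phi> j x))"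

lemma wL2_inner_cong:
  fixes w :: "real ^ 'd \<Rightarrow> real"
  assumes w: "normalized_weight \<Omega> w"
    and meas: "\<phi> \<in> borel_measurable (lebesgue_on \<Omega>)" "\<phi>' \<in> borel_measurable (lebesgue_on \<Omega>)"
      "\<psi> \<in> borel_measurable (lebesgue_on \<Omega>)" "\<psi>' \<in> borel_measurable (lebesgue_on \<Omega>)"
    and ae: "AE x in density (lebesgue_on \<Omega>) (\<lambda>x. ennreal (w x)). \<phi> x = \<phi>' x"
      "AE x in density (lebesgue_on \<Omega>) (\<lambda>x. ennreal (w x)). \<psi> x = \<psi>' x"
  shows "wL2_inner \<Omega> w \<phi> \<psi> = wL2_inner \<Omega> w \<phi>' \<psi>'"
proof -
  have [measurable]: "w \<in> borel_measurable (lebesgue_on \<Omega>)"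
    using w by (auto simp: normalized_weight_def)
  note [measurable] = meas
  have nonneg: "AE x in lebesgue_on \<Omega>. 0 \<le> w x"
    using w by (intro AE_I2) (auto simp: normalized_weight_def)
  have "AE x in lebesgue_on \<Omega>. 0 < w x \<longrightarrow> \<phi> x = \<phi>' x"
    and "AE x in lebesgue_on \<Omega>. 0 < w x \<longrightarrow> \<psi> x = \<psi>' x"
    using ae by (simp_all add: AE_density)
  with nonneg have "AE x in lebesgue_on \<Omega>.
      cnj (\<phi> x) * \<psi> x * complex_of_real (w x) = cnj (\<phi>' x) * \<psi>' x * complex_of_real (w x)"
    by eventually_elim (metis less_eq_real_def mult_zero_right of_real_0)
  moreover have "(\<lambda>x. cnj (f x) * h x * complex_of_real (w x)) \<in> borel_measurable (lebesgue_on \<Omega>)"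
    if f: "f \<in> borel_measurable (lebesgue_on \<Omega>)" and h: "h \<in> borel_measurable (lebesgue_on \<Omega>)"
    for f h :: "real ^ 'd \<Rightarrow> complex"
  proof -
    have "(\<lambda>x. cnj (f x)) \<in> borel_measurable (lebesgue_on \<Omega>)"
      using measurable_compose[OF f borel_measurable_continuous_onI[OF continuous_on_cnj[OF continuous_on_id]]]
      by simp
    moreover have "(\<lambda>x. complex_of_real (w x)) \<in> borel_measurable (lebesgue_on \<Omega>)"
      by (rule measurable_compose[OF _ borel_measurable_of_real]) fact
    ultimately show ?thesis
      using h by (intro borel_measurable_times)
  qed
  ultimately show ?thesis
    unfolding wL2_inner_def using meas by (intro integral_cong_AE) blast+
qed

end

theory Submission
  imports Defs
begin

text \<open>If \<open>M v = ev v\<close> and \<open>f = (\<Sum>j\<le>n. v\<^sub>j \<phi>\<^sub>j)\<close>, then the quadratic form of \<open>M\<close> at \<open>v\<close> is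
  the integral of \<open>g \<bar>f\<bar>\<^sup>2 w\<close>, while by orthonormality the integral of \<open>\<bar>f\<bar>\<^sup>2 w\<close> is the squared length
  of \<open>v\<close>. Hence \<open>ev\<close> is an average of \<open>g\<close> with respect to the nonnegative weight \<open>\<bar>f\<bar>\<^sup>2 w\<close>.\<close>

text \<open>The integrand is dominated by \<open>B\<close> times the sum of the densities of
  \<open>\<phi>\<close> and \<open>\<psi>\<close>. This makes each matrix entry a genuine integral
  rather than the default value 0 of a divergent one, and allows finite sums to be exchanged with
  integrals.\<close>

lemma integrable_wL2_mult:
  fixes w h :: "real ^ 'd \<Rightarrow> real"
  assumes w: "normalized_weight \<Omega> w"
    and h: "h \<in> borel_measurable (lebesgue_on \<Omega>)" and bound: "\<And>x. x \<in> \<Omega> \<Longrightarrow> \<bar>h x\<bar> \<le> B"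
    and phi: "\<phi> \<in> wL2 \<Omega> w" and psi: "\<psi> \<in> wL2 \<Omega> w"
  shows "integrable (lebesgue_on \<Omega>)
    (\<lambda>x. cnj (\<phi> x) * (complex_of_real (h x) * \<psi> x) * complex_of_real (w x))"
proof (rule Bochner_Integration.integrable_bound)
  show "integrable (lebesgue_on \<Omega>)
      (\<lambda>x. B * ((cmod (\<phi> x))\<^sup>2 * w x + (cmod (\<psi> x))\<^sup>2 * w x))"
    using phi psi by (auto simp: wL2_def)
  have "w \<in> borel_measurable (lebesgue_on \<Omega>)"
    using w by (auto simp: normalized_weight_def)
  moreover have "(\<lambda>x. cnj (\<phi> x)) \<in> borel_measurable (lebesgue_on \<Omega>)"
    using phi measurable_compose[OF _ borel_measurable_continuous_onI[OF continuous_on_cnj[OF continuous_on_id]], of \<phi>]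
    by (simp add: wL2_def)
  moreover have "\<psi> \<in> borel_measurable (lebesgue_on \<Omega>)"
    using psi by (simp add: wL2_def)
  ultimately show "(\<lambda>x. cnj (\<phi> x) * (complex_of_real (h x) * \<psi> x) * complex_of_real (w x))
      \<in> borel_measurable (lebesgue_on \<Omega>)"
    using h by (intro borel_measurable_times measurable_compose[OF _ borel_measurable_of_real])
  show "AE x in lebesgue_on \<Omega>.
      norm (cnj (\<phi> x) * (complex_of_real (h x) * \<psi> x) * complex_of_real (w x))
      \<le> norm (B * ((cmod (\<phi> x))\<^sup>2 * w x + (cmod (\<psi> x))\<^sup>2 * w x))"
  proof (rule AE_I2)
    fix x assume "x \<in> space (lebesgue_on \<Omega>)"
    then have x: "x \<in> \<Omega>" by simp
    have w0: "0 \<le> w x" using w x by (simp add: normalized_weight_def)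
    \<comment> \<open>The sign of \<open>B\<close> comes from a point of \<open>\<Omega>\<close>; it
      could not be derived outside if \<open>\<Omega>\<close> were empty.\<close>
    have B: "\<bar>h x\<bar> \<le> B" and B0: "0 \<le> B" using bound[OF x] by auto
    \<comment> \<open>Arithmetic-geometric mean inequality; its factor 2 is then dropped, since any
      integrable majorant will do.\<close>
    have "2 * (cmod (\<phi> x) * cmod (\<psi> x)) \<le> (cmod (\<phi> x))\<^sup>2 + (cmod (\<psi> x))\<^sup>2"
      using sum_squares_bound[of "cmod (\<phi> x)" "cmod (\<psi> x)"] by (simp add: mult.assoc)
    moreover have "0 \<le> cmod (\<phi> x) * cmod (\<psi> x)" by simp
    ultimately have "cmod (\<phi> x) * cmod (\<psi> x) \<le> (cmod (\<phi> x))\<^sup>2 + (cmod (\<psi> x))\<^sup>2" by linarith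
    then have "\<bar>h x\<bar> * (cmod (\<phi> x) * cmod (\<psi> x)) * w x
        \<le> B * ((cmod (\<phi> x))\<^sup>2 + (cmod (\<psi> x))\<^sup>2) * w x"
      using B B0 w0 by (intro mult_right_mono mult_mono) auto
    moreover have "0 \<le> B * ((cmod (\<phi> x))\<^sup>2 * w x + (cmod (\<psi> x))\<^sup>2 * w x)"
      using B0 w0 by simp
    ultimately show "norm (cnj (\<phi> x) * (complex_of_real (h x) * \<psi> x) * complex_of_real (w x))
      \<le> norm (B * ((cmod (\<phi> x))\<^sup>2 * w x + (cmod (\<psi> x))\<^sup>2 * w x))"
      using w0 by (simp add: norm_mult algebra_simps)
  qed
qed

text \<open>Expanding the squared modulus as conjugate times value gives a finite double sum that is
  integrated term by term. The case \<open>h = g\<close> gives the quadratic form of the matrix, the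
  case \<open>h = 1\<close> that of the Gram matrix.\<close>

lemma wL2_quadratic_form:
  fixes w h :: "real ^ 'd \<Rightarrow> real" and c :: "nat \<Rightarrow> complex"
  assumes w: "normalized_weight \<Omega> w"
    and h: "h \<in> borel_measurable (lebesgue_on \<Omega>)" and bound: "\<And>x. x \<in> \<Omega> \<Longrightarrow> \<bar>h x\<bar> \<le> B"
    and phi: "\<And>i. i \<in> I \<Longrightarrow> \<phi> i \<in> wL2 \<Omega> w"
  shows "integrable (lebesgue_on \<Omega>) (\<lambda>x. h x * (cmod (\<Sum>j\<in>I. c j * \<phi> j x))\<^sup>2 * w x)"
    and "(\<Sum>i\<in>I. \<Sum>j\<in>I. cnj (c i) * c j * wL2_inner \<Omega> w (\<phi> i) (\<lambda>x. complex_of_real (h x) * \<phi> j x))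
      = complex_of_real (LINT x|lebesgue_on \<Omega>. h x * (cmod (\<Sum>j\<in>I. c j * \<phi> j x))\<^sup>2 * w x)"
proof -
  let ?k = "\<lambda>i j x. cnj (\<phi> i x) * (complex_of_real (h x) * \<phi> j x) * complex_of_real (w x)"
  let ?q = "\<lambda>x. h x * (cmod (\<Sum>j\<in>I. c j * \<phi> j x))\<^sup>2 * w x"
  have int: "integrable (lebesgue_on \<Omega>) (?k i j)" if "i \<in> I" "j \<in> I" for i j
    using integrable_wL2_mult[OF w h bound phi phi] that by blast
  have eq: "complex_of_real (?q x) = (\<Sum>i\<in>I. \<Sum>j\<in>I. cnj (c i) * c j * ?k i j x)" for x
  proof -
    let ?f = "\<Sum>j\<in>I. c j * \<phi> j x"
    have "complex_of_real (?q x) = cnj ?f * ?f * (complex_of_real (h x) * complex_of_real (w x))"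
      unfolding of_real_mult complex_norm_square by (simp only: mult_ac)
    also have "cnj ?f * ?f = (\<Sum>i\<in>I. \<Sum>j\<in>I. cnj (c i * \<phi> i x) * (c j * \<phi> j x))"
      by (simp only: cnj_sum sum_product)
    also have "(\<Sum>i\<in>I. \<Sum>j\<in>I. cnj (c i * \<phi> i x) * (c j * \<phi> j x))
        * (complex_of_real (h x) * complex_of_real (w x)) = (\<Sum>i\<in>I. \<Sum>j\<in>I. cnj (c i) * c j * ?k i j x)"
      by (simp add: sum_distrib_left mult_ac)
    finally show ?thesis .
  qed
  \<comment> \<open>The expansion exists only over the complex numbers, so integrability is shown
    there and pulled back to the real integrand.\<close>
  have intq: "integrable (lebesgue_on \<Omega>) (\<lambda>x. complex_of_real (?q x))"
    unfolding eq using int by (intro Bochner_Integration.integrable_sum integrable_mult_right) auto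
  then show "integrable (lebesgue_on \<Omega>) ?q"
    by (simp only: complex_of_real_integrable_eq)
  have "complex_of_real (LINT x|lebesgue_on \<Omega>. ?q x) = (LINT x|lebesgue_on \<Omega>. complex_of_real (?q x))"
    by (rule integral_complex_of_real[symmetric])
  also have "\<dots> = (\<Sum>i\<in>I. \<Sum>j\<in>I. cnj (c i) * c j * (LINT x|lebesgue_on \<Omega>. ?k i j x))"
    unfolding eq using int
    by (subst Bochner_Integration.integral_sum, force intro: Bochner_Integration.integrable_sum integrable_mult_right)
      (intro sum.cong refl, subst Bochner_Integration.integral_sum, auto)
  finally show "(\<Sum>i\<in>I. \<Sum>j\<in>I. cnj (c i) * c j * wL2_inner \<Omega> w (\<phi> i) (\<lambda>x. complex_of_real (h x) * \<phi> j x))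
      = complex_of_real (LINT x|lebesgue_on \<Omega>. ?q x)"
    by (simp add: wL2_inner_def)
qed

theorem theorem1:
  fixes \<Omega> :: "(real ^ 'd) set"
    and w g :: "real ^ 'd \<Rightarrow> real"
    and \<phi> :: "nat \<Rightarrow> real ^ 'd \<Rightarrow> complex"
    and n :: nat
  assumes "\<Omega> \<in> sets lebesgue"
    and "normalized_weight \<Omega> w"
    and "g \<in> borel_measurable (lebesgue_on \<Omega>)"
    and "bounded (g ` \<Omega>)"
    and "wL2_orthonormal \<Omega> w n \<phi>"
  shows "{ev. eigenvalue (multiplication_matrix \<Omega> w \<phi> n g) ev}
           \<subseteq> complex_of_real ` {(INF x\<in>\<Omega>. g x)..(SUP x\<in>\<Omega>. g x)}"
proof
  fix ev assume "ev \<in> {ev. eigenvalue (multiplication_matrix \<Omega> w \<phi> n g) ev}"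
  then obtain v where v: "v \<in> carrier_vec (n + 1)" "v \<noteq> 0\<^sub>v (n + 1)"
    and ev: "multiplication_matrix \<Omega> w \<phi> n g *\<^sub>v v = ev \<cdot>\<^sub>v v"
    by (auto simp: eigenvalue_def eigenvector_def multiplication_matrix_def)
  \<comment> \<open>Only the values of \<open>c\<close> at indices up to \<open>n\<close> are
    coordinates of \<open>v\<close>; every sum below stays in that range.\<close>
  define c where "c = vec_index v"
  define F where "F x = (cmod (\<Sum>j\<le>n. c j * \<phi> j x))\<^sup>2 * w x" for x
  define S where "S = (\<Sum>i\<le>n. (cmod (c i))\<^sup>2)"
  obtain B where B: "\<And>x. x \<in> \<Omega> \<Longrightarrow> \<bar>g x\<bar> \<le> B"
    using assms(4) by (auto simp: bounded_iff)
  have phi: "\<phi> i \<in> wL2 \<Omega> w" if "i \<in> {..n}" for i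
    using assms(5) that by (simp add: wL2_orthonormal_def)
  have orth: "wL2_inner \<Omega> w (\<phi> i) (\<phi> j) = (if i = j then 1 else 0)" if "i \<le> n" "j \<le> n" for i j
    using assms(5) that by (simp add: wL2_orthonormal_def)

  \<comment> \<open>The eigenvector equation read coordinatewise, with the index range
    \<open>{0..<n + 1}\<close> of the scalar product turned into \<open>{..n}\<close>.\<close>
  have row: "(\<Sum>j\<le>n. wL2_inner \<Omega> w (\<phi> i) (\<lambda>x. complex_of_real (g x) * \<phi> j x) * c j) = ev * c i"
    if "i \<le> n" for i
  proof -
    have "vec_index (multiplication_matrix \<Omega> w \<phi> n g *\<^sub>v v) i = vec_index (ev \<cdot>\<^sub>v v) i"
      by (simp only: ev)
    then show ?thesis
      using that v(1)
      by (simp add: multiplication_matrix_def scalar_prod_def c_def atLeast0LessThan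
          lessThan_Suc_atMost del: sum.lessThan_Suc)
  qed

  \<comment> \<open>Parseval for the finite sum: with \<open>h = 1\<close> the Gram matrix is the
    identity and only the diagonal survives. The factor \<open>complex_of_real 1\<close> keeps the
    shape of the quadratic form lemma.\<close>
  have "(\<Sum>i\<le>n. \<Sum>j\<le>n. cnj (c i) * c j * wL2_inner \<Omega> w (\<phi> i) (\<lambda>x. complex_of_real 1 * \<phi> j x))
      = (\<Sum>i\<le>n. \<Sum>j\<le>n. if i = j then cnj (c i) * c j else 0)"
    by (intro sum.cong refl) (simp add: orth)
  also have "\<dots> = complex_of_real S"
    by (simp add: S_def complex_norm_square mult.commute del: of_real_power)
  finally have "complex_of_real (LINT x|lebesgue_on \<Omega>. F x) = complex_of_real S"
    using wL2_quadratic_form(2)[where h = "\<lambda>_. 1" and B = 1 and I = "{..n}" and c = c, OF assms(2) _ _ phi]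
    by (simp add: F_def)
  then have S: "(LINT x|lebesgue_on \<Omega>. F x) = S"
    by (simp only: of_real_eq_iff)
  have intF: "integrable (lebesgue_on \<Omega>) F"
    using wL2_quadratic_form(1)[where h = "\<lambda>_. 1" and B = 1 and I = "{..n}" and c = c, OF assms(2) _ _ phi]
    by (simp add: F_def[abs_def])
  have intgF: "integrable (lebesgue_on \<Omega>) (\<lambda>x. g x * F x)"
    using wL2_quadratic_form(1)[where I = "{..n}" and c = c, OF assms(2,3) B phi]
    by (simp add: F_def[abs_def] mult.assoc)

  have "complex_of_real (LINT x|lebesgue_on \<Omega>. g x * F x)
      = (\<Sum>i\<le>n. \<Sum>j\<le>n. cnj (c i) * c j * wL2_inner \<Omega> w (\<phi> i) (\<lambda>x. complex_of_real (g x) * \<phi> j x))"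
    using wL2_quadratic_form(2)[where I = "{..n}" and c = c, OF assms(2,3) B phi]
    by (simp add: F_def mult.assoc)
  also have "\<dots> = (\<Sum>i\<le>n. cnj (c i) *
      (\<Sum>j\<le>n. wL2_inner \<Omega> w (\<phi> i) (\<lambda>x. complex_of_real (g x) * \<phi> j x) * c j))"
    by (simp add: sum_distrib_left mult_ac)
  also have "\<dots> = (\<Sum>i\<le>n. cnj (c i) * (ev * c i))"
    by (intro sum.cong refl) (simp add: row)
  also have "\<dots> = ev * complex_of_real S"
    by (simp add: S_def complex_norm_square sum_distrib_left mult_ac del: of_real_power)
  finally have quad: "complex_of_real (LINT x|lebesgue_on \<Omega>. g x * F x) = ev * complex_of_real S" .

  \<comment> \<open>An eigenvector is nonzero, which makes \<open>S\<close> positive and permits the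
    division by it below.\<close>
  have "\<exists>i\<le>n. c i \<noteq> 0"
  proof (rule ccontr)
    assume "\<not> ?thesis"
    then have "v = 0\<^sub>v (n + 1)"
      using v(1) by (intro eq_vecI) (auto simp: c_def less_Suc_eq_le)
    with v(2) show False by simp
  qed
  then have "0 < S"
    unfolding S_def by (auto intro: sum_pos2)

  have F0: "0 \<le> F x" if "x \<in> \<Omega>" for x
    using assms(2) that by (simp add: F_def normalized_weight_def)
  \<comment> \<open>The reals are only conditionally complete, so comparing \<open>g x\<close> with
    its infimum and supremum needs these bounds.\<close>
  have bdd: "bdd_below (g ` \<Omega>)" "bdd_above (g ` \<Omega>)"
    using assms(4) by (auto intro: bounded_imp_bdd_below bounded_imp_bdd_above)
  \<comment> \<open>With \<open>S\<close> written as the integral of \<open>F\<close>, this is the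
    pointwise bound on \<open>g\<close>, multiplied by \<open>F x \<ge> 0\<close> and
    integrated.\<close>
  have "(INF x\<in>\<Omega>. g x) * S \<le> (LINT x|lebesgue_on \<Omega>. g x * F x)"
    unfolding S[symmetric] integral_mult_right_zero[symmetric]
    using bdd F0 intF intgF
    by (intro integral_mono) (auto intro!: mult_right_mono cINF_lower)
  moreover have "(LINT x|lebesgue_on \<Omega>. g x * F x) \<le> (SUP x\<in>\<Omega>. g x) * S"
    unfolding S[symmetric] integral_mult_right_zero[symmetric]
    using bdd F0 intF intgF
    by (intro integral_mono) (auto intro!: mult_right_mono cSUP_upper)
  ultimately have "(LINT x|lebesgue_on \<Omega>. g x * F x) / S \<in> {(INF x\<in>\<Omega>. g x)..(SUP x\<in>\<Omega>. g x)}"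
    using \<open>0 < S\<close> by (simp add: field_simps)
  \<comment> \<open>This also shows that \<open>ev\<close> is real, as a quotient of real numbers,
    without a separate appeal to Hermitian symmetry.\<close>
  moreover have "ev = complex_of_real ((LINT x|lebesgue_on \<Omega>. g x * F x) / S)"
    using quad \<open>0 < S\<close> by (simp add: field_simps)
  ultimately show "ev \<in> complex_of_real ` {(INF x\<in>\<Omega>. g x)..(SUP x\<in>\<Omega>. g x)}"
    by blast
qed

end
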